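(* Let $\mathcal N$ be the largest part of the square-cutting partition $\mathcal P$ and $F(u)=\Pr(\mathcal N\le u)$. Then $F(u)=\Pi(1/u)$ for all $u>0$, where $\Pi:(0,\infty)\to[0,1]$ is the function with $\Pi(u)=1$ for $u\in(0,1]$ and $$\Pi(u)=\frac1u(\Pi*\rho)(u)=\frac1u\int_0^u\Pi(t)\rho(u-t)\,dt\qquad(u>1),$$ with $\rho$ the Dickman function.
   Context: Square-cutting partition: with $\{U_{i,j}\}_{i,j\ge1}$ iid uniform on $[0,1]$, $\mathcal P$ is the random partition of unity (multiset of nonnegative numbers summing to 1) whose parts are, for $i\ge1$, $j\ge2$, $\big(\prod_{r=1}^{i-1}(1-U_{r,1})\big)U_{i,1}\big(\prod_{s=2}^{j-1}(1-U_{i,s})\big)U_{i,j}$. The Dickman function $\rho$ is the unique continuous function on $[0,\infty)$ with $\rho(u)=1$ on $[0,1]$ and $u\rho'(u)+\rho(u-1)=0$ for $u>1$; in the convolution above $\Pi$ is extended by $\Pi(0)=1$. *)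

theory Defs
  imports "HOL-Probability.Probability"
begin

text \<open>Dickman function: continuous on [0,oo), equal to 1 on [0,1],
  and u rho'(u) + rho(u-1) = 0 for u > 1.  Values at negative arguments are irrelevant.\<close>
definition is_dickman :: "(real \<Rightarrow> real) \<Rightarrow> bool" where
  "is_dickman rho \<longleftrightarrow>
     continuous_on {0..} rho \<and>
     (\<forall>u\<in>{0..1}. rho u = 1) \<and>
     (\<forall>u>1. (rho has_real_derivative (- rho (u - 1) / u)) (at u))"

text \<open>The part with indices i >= 1, j >= 2 of the square-cutting partition.\<close>
definition square_part :: "(nat \<times> nat \<Rightarrow> 'a \<Rightarrow> real) \<Rightarrow> nat \<Rightarrow> nat \<Rightarrow> 'a \<Rightarrow> real" where
  "square_part U i j \<omega> =
     (\<Prod>r\<in>{1..<i}. 1 - U (r, 1) \<omega>) * U (i, 1) \<omega> *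
     (\<Prod>s\<in>{2..<j}. 1 - U (i, s) \<omega>) * U (i, j) \<omega>"

definition largest_part :: "(nat \<times> nat \<Rightarrow> 'a \<Rightarrow> real) \<Rightarrow> 'a \<Rightarrow> ereal" where
  "largest_part U \<omega> = (SUP p\<in>{(i, j). 1 \<le> i \<and> 2 \<le> j}. ereal (square_part U (fst p) (snd p) \<omega>))"

definition is_Pi :: "(real \<Rightarrow> real) \<Rightarrow> (real \<Rightarrow> real) \<Rightarrow> bool" where
  "is_Pi rho Pf \<longleftrightarrow>
     Pf 0 = 1 \<and>
     (\<forall>u>0. 0 \<le> Pf u \<and> Pf u \<le> 1) \<and>
     (\<forall>u\<in>{0<..1}. Pf u = 1) \<and>
     (\<forall>u>1. (\<lambda>t. Pf t * rho (u - t)) integrable_on {0..u} \<and>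
            Pf u = integral {0..u} (\<lambda>t. Pf t * rho (u - t)) / u)"

end

theory Submission
  imports Defs
begin

text \<open>Write \<open>G(x)\<close> for the probability that all parts of \<open>x * P\<close> are at most \<open>1\<close>. The first row of
  the array breaks \<open>x\<close> into \<open>x * w\<close>, which is then cut by an independent stick-breaking process, and
  \<open>x * (1 - w)\<close>, which carries an independent copy of the whole construction. Hence
  \<open>G(x)\<close> is the integral of \<open>R(x * w) * G(x * (1 - w))\<close> over \<open>w\<close> in \<open>[0,1]\<close>, where \<open>R\<close> is the
  analogue of \<open>G\<close> for stick breaking; substituting \<open>t = x * (1 - w)\<close> gives the convolution equation.
  The same recursion one level lower, with the indicator of \<open>x * w \<le> 1\<close> in place of \<open>R(x * w)\<close>, gives
  the delay equation of the Dickman function for \<open>R\<close>. Both equations are of Volterra type and have at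
  most one locally bounded solution extending the constant \<open>1\<close> on \<open>[0,1]\<close>.\<close>

section \<open>Breaking processes and their first-step recursion\<close>

text \<open>A stick of length \<open>x\<close> is broken successively by \<open>s 0, s 1, \<dots>\<close>, where \<open>W (s n)\<close> is the fraction
  broken off at step \<open>n\<close>; \<open>A y a\<close> says that a piece of size \<open>y\<close> broken off by \<open>a\<close> is admissible.
  In the outer level of the square-cutting partition each \<open>s n\<close> is itself an infinite row, whose tail
  determines how the piece is cut further.\<close>
definition pieces_ok :: "(real \<Rightarrow> 'b \<Rightarrow> bool) \<Rightarrow> ('b \<Rightarrow> real) \<Rightarrow> real \<Rightarrow> (nat \<Rightarrow> 'b) \<Rightarrow> bool" where
  "pieces_ok A W x s \<longleftrightarrow> (\<forall>n. A (x * (\<Prod>r<n. 1 - W (s r)) * W (s n)) (s n))"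

definition pieces_prob :: "(real \<Rightarrow> 'b \<Rightarrow> bool) \<Rightarrow> ('b \<Rightarrow> real) \<Rightarrow> 'b measure \<Rightarrow> real \<Rightarrow> real" where
  "pieces_prob A W M x =
     measure (\<Pi>\<^sub>M n\<in>(UNIV :: nat set). M)
       {s \<in> space (\<Pi>\<^sub>M n\<in>(UNIV :: nat set). M). pieces_ok A W x s}"

lemma pieces_ok_case_nat:
  "pieces_ok A W x (case_nat a s) \<longleftrightarrow> A (x * W a) a \<and> pieces_ok A W (x * (1 - W a)) s"
proof -
  have split: "(\<forall>n. P n) \<longleftrightarrow> P 0 \<and> (\<forall>n. P (Suc n))" for P :: "nat \<Rightarrow> bool"
    by (metis not0_implies_Suc)
  show ?thesis
    unfolding pieces_ok_def by (subst split) (simp add: prod.lessThan_Suc_shift mult.assoc del: prod.lessThan_Suc)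
qed

lemma pred_compose_Pair:
  assumes "Measurable.pred (borel \<Otimes>\<^sub>M M) (\<lambda>p. A (fst p) (snd p))"
    and "f \<in> borel_measurable N" "g \<in> measurable N M"
  shows "Measurable.pred N (\<lambda>z. A (f z) (g z))"
  using measurable_compose[OF measurable_Pair[OF assms(2,3)] assms(1)] by simp

lemma pred_pieces_ok:
  assumes A: "Measurable.pred (borel \<Otimes>\<^sub>M M) (\<lambda>p. A (fst p) (snd p))"
    and [measurable]: "W \<in> borel_measurable M"
  shows "Measurable.pred (borel \<Otimes>\<^sub>M (\<Pi>\<^sub>M n\<in>(UNIV :: nat set). M)) (\<lambda>p. pieces_ok A W (fst p) (snd p))"
  unfolding pieces_ok_def
  by (intro pred_intros_countable pred_compose_Pair[OF A]) measurable

text \<open>An iid sequence keeps its law when an independent term is put in front, so conditioning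
  on the first term and Fubini give the recursion. Stating it in \<open>ennreal\<close> avoids
  integrability questions.\<close>

lemma
  assumes "prob_space M"
    and A: "Measurable.pred (borel \<Otimes>\<^sub>M M) (\<lambda>p. A (fst p) (snd p))"
    and W[measurable]: "W \<in> borel_measurable M"
  shows pieces_prob_nonneg: "0 \<le> pieces_prob A W M x"
    and pieces_prob_le_1: "pieces_prob A W M x \<le> 1"
    and borel_measurable_pieces_prob: "pieces_prob A W M \<in> borel_measurable borel"
    and pieces_prob_rec: "ennreal (pieces_prob A W M x) =
          (\<integral>\<^sup>+a. ennreal (of_bool (A (x * W a) a) * pieces_prob A W M (x * (1 - W a))) \<partial>M)"
proof -
  interpret prob_space M by fact
  interpret sequence_space M by unfold_locales
  let ?P = "pieces_prob A W M"
  show "0 \<le> ?P x" "?P x \<le> 1"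
    by (simp_all add: pieces_prob_def P.prob_le_1)
  have em: "emeasure S {s \<in> space S. pieces_ok A W y s} = ennreal (?P y)" for y
    by (simp add: pieces_prob_def P.emeasure_eq_measure)
  show "?P \<in> borel_measurable borel"
  proof -
    let ?Q = "{p \<in> space (borel \<Otimes>\<^sub>M S). pieces_ok A W (fst p) (snd p)}"
    have Q: "?Q \<in> sets (borel \<Otimes>\<^sub>M S)"
      using pred_pieces_ok[OF A W] by simp
    \<comment> \<open>The probability at length \<open>y\<close> is the measure of the slice at
      \<open>y\<close> of one jointly measurable set, hence measurable in \<open>y\<close>.\<close>
    have "Pair y -` ?Q = {s \<in> space S. pieces_ok A W y s}" for y
      by (auto simp: space_pair_measure)
    with P.measurable_emeasure_Pair[OF Q]
    have "(\<lambda>y. ennreal (?P y)) \<in> borel_measurable borel"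
      by (simp add: em)
    then have "(\<lambda>y. enn2real (ennreal (?P y))) \<in> borel_measurable borel"
      by measurable
    then show ?thesis
      by (simp add: pieces_prob_def[abs_def])
  qed
  have okx: "Measurable.pred S (pieces_ok A W x)"
    using pred_compose_Pair[OF pred_pieces_ok[OF A W], of "\<lambda>_. x" S "\<lambda>s. s"] by simp
  let ?c = "\<lambda>(a, s). case_nat a s"
  let ?E = "{s \<in> space S. pieces_ok A W x s}"
  let ?R = "?c -` ?E \<inter> space (M \<Otimes>\<^sub>M S)"
  have c: "?c \<in> measurable (M \<Otimes>\<^sub>M S) S"
    by measurable
  have E: "?E \<in> sets S" using okx by simp
  have R: "?R \<in> sets (M \<Otimes>\<^sub>M S)" using c E by (rule measurable_sets)
  have slice: "Pair a -` ?R =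
      (if A (x * W a) a then {s \<in> space S. pieces_ok A W (x * (1 - W a)) s} else {})"
    if "a \<in> space M" for a
    using that measurable_space[OF c, of "(a, _)"]
    by (auto simp: space_pair_measure pieces_ok_case_nat)
  have "ennreal (?P x) = emeasure (distr (M \<Otimes>\<^sub>M S) S ?c) ?E"
    unfolding PiM_iter by (rule em[symmetric])
  also have "\<dots> = emeasure (M \<Otimes>\<^sub>M S) ?R"
    using c E by (rule emeasure_distr)
  also have "\<dots> = (\<integral>\<^sup>+a. emeasure S (Pair a -` ?R) \<partial>M)"
    using R by (rule P.emeasure_pair_measure_alt)
  also have "\<dots> = (\<integral>\<^sup>+a. ennreal (of_bool (A (x * W a) a) * ?P (x * (1 - W a))) \<partial>M)"
    by (intro nn_integral_cong) (simp only: slice, simp add: em)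
  finally show "ennreal (?P x) = \<dots>" .
qed

section \<open>Uniform fractions and sure events\<close>

abbreviation "unif \<equiv> uniform_measure lborel {0..1::real}"

lemma prob_space_unif: "prob_space unif"
  by (rule prob_space_uniform_measure) auto

lemma AE_unif: "AE x in unif. x \<in> {0..1}"
  by (rule AE_uniform_measureI) auto

lemma nn_integral_unif:
  "f \<in> borel_measurable borel \<Longrightarrow> (\<integral>\<^sup>+x. f x \<partial>unif) = (\<integral>\<^sup>+x. f x * indicator {0..1} x \<partial>lborel)"
  by (subst nn_integral_uniform_measure) (auto simp: divide_ennreal_def)

lemma pieces_prob_eq_1:
  assumes "prob_space M"
    and A: "Measurable.pred (borel \<Otimes>\<^sub>M M) (\<lambda>p. A (fst p) (snd p))"
    and W: "W \<in> borel_measurable M"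
    and ok: "AE s in (\<Pi>\<^sub>M n\<in>(UNIV :: nat set). M). pieces_ok A W x s"
  shows "pieces_prob A W M x = 1"
proof -
  interpret prob_space M by fact
  interpret sequence_space M by unfold_locales
  have "Measurable.pred S (pieces_ok A W x)"
    using pred_compose_Pair[OF pred_pieces_ok[OF A W], of "\<lambda>_. x" S "\<lambda>s. s"] by simp
  then show ?thesis
    unfolding pieces_prob_def using ok by (intro P.prob_Collect_eq_1[THEN iffD2]) auto
qed

lemma AE_nat_PiM:
  assumes "prob_space M" "AE a in M. P a"
  shows "AE s in (\<Pi>\<^sub>M n\<in>(UNIV :: nat set). M). \<forall>n. P (s n)"
  unfolding AE_all_countable using assms by (intro allI AE_PiM_component) auto

lemma stick_piece_bounds:
  fixes v :: "nat \<Rightarrow> real"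
  assumes "\<And>n. v n \<in> {0..1}" "0 \<le> x" "x \<le> 1"
  shows "x * (\<Prod>r<n. 1 - v r) * v n \<in> {0..1}"
proof -
  have unit: "a * b \<in> {0..1}" if "a \<in> {0..1}" "b \<in> {0..1}" for a b :: real
    using that by (simp add: mult_le_one)
  have "(\<Prod>r<n. 1 - v r) \<in> {0..1}"
    using assms(1) by (simp add: prod_nonneg prod_le_1)
  moreover have "x \<in> {0..1}"
    using assms(2,3) by simp
  ultimately show ?thesis
    using assms(1) by (intro unit)
qed

section \<open>Integral equations and their uniqueness\<close>

text \<open>The substitution \<open>t = x * (1 - w)\<close> turns the average over \<open>w\<close>
  into a convolution, and its Jacobian is the factor \<open>x\<close>. Nonnegativity allows the
  computation to run in \<open>ennreal\<close> before passing to
  \<open>has_integral\<close>.\<close>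

lemma convolution_equation:
  fixes G \<phi> :: "real \<Rightarrow> real"
  assumes [measurable]: "G \<in> borel_measurable borel" "\<phi> \<in> borel_measurable borel"
    and nonneg: "\<And>x. 0 \<le> G x" "\<And>x. 0 \<le> \<phi> x"
    and rec: "ennreal (G x) = (\<integral>\<^sup>+w. ennreal (\<phi> (x * w) * G (x * (1 - w))) \<partial>unif)"
    and "0 < x"
  shows "((\<lambda>t. G t * \<phi> (x - t)) has_integral x * G x) {0..x}"
proof -
  \<comment> \<open>Extension by zero lets the affine substitution act on the whole line;
    \<open>ind\<close> translates the cut-off back to \<open>w\<close> in
    \<open>[0,1]\<close>.\<close>
  let ?K = "\<lambda>t. if t \<in> {0..x} then G t * \<phi> (x - t) else 0"
  have subst: "x + - x * w = x * (1 - w)" "x - x * (1 - w) = x * w" for w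
    by (simp_all add: right_diff_distrib)
  have ind: "x * (1 - w) \<in> {0..x} \<longleftrightarrow> w \<in> {0..1}" for w
    using \<open>0 < x\<close> by (auto simp: zero_le_mult_iff mult_le_cancel_left2)
  have "(\<integral>\<^sup>+t. ennreal (?K t) \<partial>lborel) = ennreal \<bar>- x\<bar> * (\<integral>\<^sup>+w. ennreal (?K (x + - x * w)) \<partial>lborel)"
    using \<open>0 < x\<close> by (intro nn_integral_real_affine) auto
  also have "(\<integral>\<^sup>+w. ennreal (?K (x + - x * w)) \<partial>lborel) =
      (\<integral>\<^sup>+w. ennreal (\<phi> (x * w) * G (x * (1 - w))) * indicator {0..1} w \<partial>lborel)"
    unfolding subst ind
    by (intro nn_integral_cong) (simp add: mult.commute[of "G _"] indicator_def)
  also have "\<dots> = ennreal (G x)"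
    unfolding rec by (rule nn_integral_unif[symmetric]) measurable
  also have "ennreal \<bar>- x\<bar> * ennreal (G x) = ennreal (x * G x)"
    using \<open>0 < x\<close> by (simp add: ennreal_mult nonneg)
  finally have "(?K has_integral x * G x) UNIV"
    using \<open>0 < x\<close> nonneg by (intro nn_integral_has_integral) auto
  then show ?thesis
    by (subst (asm) has_integral_restrict_UNIV)
qed

text \<open>Each use of the equations gains one integration: the bound
  \<open>B * (u ^ n / fact n)\<close> on the difference improves to the one for
  \<open>Suc n\<close>, and these bounds tend to zero. Dividing by \<open>u\<close> is harmless
  because \<open>u > 1\<close>.\<close>

lemma volterra_unique:
  fixes f g :: "real \<Rightarrow> real" and k :: "real \<Rightarrow> real \<Rightarrow> real"
  assumes init: "\<And>u. 0 \<le> u \<Longrightarrow> u \<le> 1 \<Longrightarrow> f u = g u"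
    and f: "\<And>u. 1 < u \<Longrightarrow> ((\<lambda>t. f t * k u t) has_integral u * f u) {0..u}"
    and g: "\<And>u. 1 < u \<Longrightarrow> ((\<lambda>t. g t * k u t) has_integral u * g u) {0..u}"
    and k: "\<And>u t. 0 \<le> t \<Longrightarrow> t \<le> u \<Longrightarrow> \<bar>k u t\<bar> \<le> 1"
    and bounded: "\<And>u. 0 \<le> u \<Longrightarrow> u \<le> T \<Longrightarrow> \<bar>f u - g u\<bar> \<le> B"
    and "0 \<le> T"
  shows "f T = g T"
proof -
  have B: "0 \<le> B" using bounded[of T] \<open>0 \<le> T\<close> by simp
  have bound: "0 \<le> u \<Longrightarrow> u \<le> T \<Longrightarrow> \<bar>f u - g u\<bar> \<le> B * (u ^ n / fact n)" for n u
  proof (induction n arbitrary: u)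
    case 0
    then show ?case using bounded by simp
  next
    case (Suc n)
    show ?case
    proof (cases "u \<le> 1")
      case True
      then show ?thesis using Suc.prems B init by simp
    next
      case False
      let ?I = "B * (u ^ Suc n / fact (Suc n))"
      have D: "((\<lambda>t. (f t - g t) * k u t) has_integral u * (f u - g u)) {0..u}"
        using has_integral_diff[OF f g, of u] False by (simp add: algebra_simps)
      \<comment> \<open>Cancelling \<open>Suc n\<close> against the factorial makes the bound for
        \<open>Suc n\<close> an antiderivative of the inductive bound.\<close>
      have "real (Suc n) * t ^ n / fact (Suc n) = t ^ n / fact n" for t :: real
        by (simp add: fact_Suc del: of_nat_Suc)
      then have "((\<lambda>t. B * (t ^ Suc n / fact (Suc n))) has_real_derivative B * (t ^ n / fact n))
          (at t within {0..u})" for t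
        using DERIV_cmult[OF DERIV_cdivide[OF DERIV_pow[of "Suc n" t "{0..u}"], of "fact (Suc n)"], of B]
        by (simp del: power_Suc fact_Suc of_nat_Suc)
      then have I: "((\<lambda>t. B * (t ^ n / fact n)) has_integral
          ?I - B * (0 ^ Suc n / fact (Suc n))) {0..u}"
        using Suc.prems
        by (intro fundamental_theorem_of_calculus)
           (auto simp flip: has_real_derivative_iff_has_vector_derivative simp del: power_Suc fact_Suc)
      have "norm (u * (f u - g u)) \<le> ?I"
        unfolding integral_unique[OF D, symmetric]
      proof (rule order_trans[OF integral_norm_bound_integral])
        show "(\<lambda>t. (f t - g t) * k u t) integrable_on {0..u}" using D by blast
        show "(\<lambda>t. B * (t ^ n / fact n)) integrable_on {0..u}" using I by blast
        show "integral {0..u} (\<lambda>t. B * (t ^ n / fact n)) \<le> ?I"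
          using integral_unique[OF I] by simp
        show "norm ((f t - g t) * k u t) \<le> B * (t ^ n / fact n)" if "t \<in> {0..u}" for t
          using mult_mono[OF Suc.IH[of t] k[of t u]] that Suc.prems B by (simp add: abs_mult)
      qed
      moreover have "\<bar>f u - g u\<bar> \<le> \<bar>u * (f u - g u)\<bar>"
        using False by (simp add: abs_mult mult_le_cancel_right1)
      ultimately show ?thesis by simp
    qed
  qed
  have "(\<lambda>n. B * (T ^ n / fact n)) \<longlonglongrightarrow> B * 0"
    using summable_LIMSEQ_zero[OF summable_exp[of T]]
    by (intro tendsto_mult tendsto_const) (simp add: divide_inverse mult.commute)
  then have "\<bar>f T - g T\<bar> \<le> B * 0"
    by (rule LIMSEQ_le_const) (use bound \<open>0 \<le> T\<close> in auto)
  then show ?thesis by simp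
qed

section \<open>The Dickman function in integral form\<close>

text \<open>Integrating the differential equation once gives the Volterra form that stick breaking
  also satisfies.\<close>

lemma dickman_delay_equation:
  assumes rho: "is_dickman rho" and "1 < u"
  shows "((\<lambda>t. rho t * of_bool (u - t \<le> 1)) has_integral u * rho u) {0..u}"
proof -
  have cont: "continuous_on {0..} rho"
    and one: "\<And>u. 0 \<le> u \<Longrightarrow> u \<le> 1 \<Longrightarrow> rho u = 1"
    and deriv: "\<And>u. 1 < u \<Longrightarrow> (rho has_real_derivative - rho (u - 1) / u) (at u)"
    using rho by (auto simp: is_dickman_def)
  define P where "P = (\<lambda>u. integral {0..u} rho)"
  have int: "rho integrable_on {a..b}" if "0 \<le> a" for a b
    by (rule integrable_continuous_real[OF continuous_on_subset[OF cont]]) (use that in auto)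
  have P_deriv: "(P has_real_derivative rho x) (at x)" if "0 < x" for x
  proof -
    have "(P has_real_derivative rho x) (at x within {0..x+1})"
      unfolding P_def
      by (rule integral_has_real_derivative[OF continuous_on_subset[OF cont]]) (use that in auto)
    moreover have "at x within {0..x+1} = at x"
      by (rule at_within_interior) (use that in auto)
    ultimately show ?thesis by simp
  qed
  have P_cont: "continuous_on {0..u} P"
    unfolding P_def by (rule indefinite_integral_continuous_1[OF int]) simp
  \<comment> \<open>Beyond \<open>1\<close>, \<open>x * rho x\<close> has derivative
    \<open>rho x - rho (x - 1)\<close>, so \<open>h\<close> is constant there; its value at
    \<open>1\<close> is zero.\<close>
  define h where "h = (\<lambda>x. x * rho x - P x + P (x - 1))"
  have "h u = h 1"
  proof (rule DERIV_isconst_end[OF \<open>1 < u\<close>])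
    show "continuous_on {1..u} h"
      unfolding h_def
      by (intro continuous_intros continuous_on_subset[OF cont] continuous_on_subset[OF P_cont]
          continuous_on_compose2[OF P_cont]) auto
    show "(h has_real_derivative 0) (at x)" if "1 < x" "x < u" for x
    proof -
      have "((\<lambda>x. P (x - 1)) has_real_derivative rho (x - 1)) (at x)"
        by (rule DERIV_chain2[where f = P and Db = 1, OF P_deriv, THEN DERIV_cong])
           (use that in \<open>auto intro!: derivative_eq_intros\<close>)
      then show ?thesis
        unfolding h_def using that
        by (auto intro!: derivative_eq_intros deriv P_deriv)
    qed
  qed
  also have "h 1 = 0"
  proof -
    have "P 1 = integral {0..1::real} (\<lambda>_. 1)"
      unfolding P_def by (rule Henstock_Kurzweil_Integration.integral_cong) (use one in auto)
    then show ?thesis by (simp add: h_def one P_def)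
  qed
  finally have "u * rho u = P u - P (u - 1)" by (simp add: h_def)
  also have "\<dots> = integral {u-1..u} rho"
    using Henstock_Kurzweil_Integration.integral_combine[of 0 "u - 1" u rho] int \<open>1 < u\<close>
    by (simp add: P_def)
  finally have "(rho has_integral u * rho u) {u-1..u}"
    using int[of "u - 1" u] \<open>1 < u\<close> by (simp add: has_integral_iff)
  \<comment> \<open>On \<open>{0..u}\<close> the condition \<open>u - t \<le> 1\<close> cuts out
    exactly \<open>{u-1..u}\<close>.\<close>
  then have "((\<lambda>t. if t \<in> {u-1..u} then rho t else 0) has_integral u * rho u) {0..u}"
    using \<open>1 < u\<close> by (subst has_integral_restrict) auto
  then show ?thesis
    by (rule has_integral_eq[rotated]) auto
qed

section \<open>The two levels of breaking\<close>

abbreviation "stick_ok \<equiv> pieces_ok (\<lambda>x _. x \<le> 1) (\<lambda>w :: real. w)"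
abbreviation "stick_prob \<equiv> pieces_prob (\<lambda>x _. x \<le> 1) (\<lambda>w. w) unif"

abbreviation "unif_seq \<equiv> \<Pi>\<^sub>M n\<in>(UNIV :: nat set). unif"

text \<open>Entry \<open>0\<close> of a row is the outer fraction, so the inner breaking starts with
  entry \<open>1\<close>.\<close>

abbreviation "row_ok \<equiv> \<lambda>x (row :: nat \<Rightarrow> real). stick_ok x (\<lambda>n. row (Suc n))"
abbreviation "square_ok \<equiv> pieces_ok row_ok (\<lambda>row. row 0)"
abbreviation "square_prob \<equiv> pieces_prob row_ok (\<lambda>row. row 0) unif_seq"

lemma prob_space_unif_seq: "prob_space unif_seq"
  by (rule prob_space_PiM) (rule prob_space_unif)

lemma pred_le_1: "Measurable.pred (borel \<Otimes>\<^sub>M unif) (\<lambda>p. fst p \<le> (1 :: real))"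
  by measurable

lemma pred_stick_ok:
  "f \<in> borel_measurable N \<Longrightarrow> g \<in> measurable N unif_seq \<Longrightarrow>
    Measurable.pred N (\<lambda>z. stick_ok (f z) (g z))"
  by (rule pred_compose_Pair[OF pred_pieces_ok[OF pred_le_1]]) measurable

lemma pred_row_ok: "Measurable.pred (borel \<Otimes>\<^sub>M unif_seq) (\<lambda>p. row_ok (fst p) (snd p))"
proof (rule pred_stick_ok)
  show "(\<lambda>p n. snd p (Suc n)) \<in> measurable (borel \<Otimes>\<^sub>M unif_seq) unif_seq"
    by (rule measurable_PiM_single') measurable
qed measurable

lemma row_0_measurable: "(\<lambda>row. row 0) \<in> borel_measurable unif_seq"
  by measurable

lemma ident_measurable_unif: "(\<lambda>w. w) \<in> borel_measurable unif"
  by measurable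

lemmas stick_facts = prob_space_unif pred_le_1 ident_measurable_unif
lemmas square_facts = prob_space_unif_seq pred_row_ok row_0_measurable

lemma stick_prob_eq_1:
  assumes "0 \<le> x" "x \<le> 1"
  shows "stick_prob x = 1"
proof (rule pieces_prob_eq_1)
  show "AE s in unif_seq. stick_ok x s"
    using AE_nat_PiM[OF prob_space_unif AE_unif]
    by eventually_elim (use stick_piece_bounds[OF _ assms] in \<open>auto simp: pieces_ok_def\<close>)
qed (use stick_facts in auto)

lemma square_prob_eq_1:
  assumes "0 \<le> x" "x \<le> 1"
  shows "square_prob x = 1"
proof (rule pieces_prob_eq_1[OF square_facts])
  show "AE s in (\<Pi>\<^sub>M n\<in>(UNIV :: nat set). unif_seq). square_ok x s"
    using AE_nat_PiM[OF prob_space_unif_seq AE_nat_PiM[OF prob_space_unif AE_unif]]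
  proof eventually_elim
    case (elim s)
    \<comment> \<open>\<open>?y n\<close> is the piece from outer step \<open>n\<close>; being in
      \<open>[0,1]\<close>, it can serve as the initial length for row \<open>n\<close>.\<close>
    let ?y = "\<lambda>n. x * (\<Prod>r<n. 1 - s r 0) * s n 0"
    have y: "?y n \<in> {0..1}" for n
      by (rule stick_piece_bounds[OF _ assms]) (use elim in auto)
    have "?y n * (\<Prod>r<m. 1 - s n (Suc r)) * s n (Suc m) \<in> {0..1}" for n m
      by (rule stick_piece_bounds[where v = "\<lambda>m. s n (Suc m)"]) (use elim y[of n] in auto)
    then show ?case by (auto simp: pieces_ok_def)
  qed
qed

text \<open>A piece broken off is not cut again at this level, so \<open>\<phi>\<close> is the
  indicator of lengths at most \<open>1\<close>.\<close>

lemma stick_prob_delay_equation: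
  assumes "0 < x"
  shows "((\<lambda>t. stick_prob t * of_bool (x - t \<le> 1)) has_integral x * stick_prob x) {0..x}"
proof (rule convolution_equation[OF _ _ _ _ _ assms])
  show "ennreal (stick_prob x) =
      (\<integral>\<^sup>+w. ennreal (of_bool (x * w \<le> 1) * stick_prob (x * (1 - w))) \<partial>unif)"
    by (rule pieces_prob_rec) (use stick_facts in auto)
qed (use borel_measurable_pieces_prob[OF stick_facts] pieces_prob_nonneg[OF stick_facts] in auto)

text \<open>The first entry of a row is independent of its tail; integrating out the tail replaces
  \<open>row_ok\<close> by \<open>stick_prob\<close>.\<close>

lemma square_prob_convolution:
  assumes "0 < x"
  shows "((\<lambda>t. square_prob t * stick_prob (x - t)) has_integral x * square_prob x) {0..x}"
proof (rule convolution_equation[OF _ _ _ _ _ assms])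
  interpret prob_space unif by (rule prob_space_unif)
  interpret sequence_space unif by unfold_locales
  have [measurable]: "square_prob \<in> borel_measurable borel"
    by (rule borel_measurable_pieces_prob[OF square_facts])
  have rok: "Measurable.pred S (\<lambda>row. row_ok (x * row 0) row)"
    by (rule pred_compose_Pair[OF pred_row_ok]) measurable
  let ?f = "\<lambda>row. ennreal (of_bool (row_ok (x * row 0) row) * square_prob (x * (1 - row 0)))"
  have f: "?f \<in> borel_measurable S"
    using rok by measurable
  have c: "(\<lambda>(w, s). case_nat w s) \<in> measurable (unif \<Otimes>\<^sub>M S) S"
    by measurable
  have "ennreal (square_prob x) = (\<integral>\<^sup>+row. ?f row \<partial>S)"
    by (rule pieces_prob_rec[OF square_facts])
  also have "\<dots> = (\<integral>\<^sup>+row. ?f row \<partial>distr (unif \<Otimes>\<^sub>M S) S (\<lambda>(w, s). case_nat w s))"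
    unfolding PiM_iter ..
  also have "\<dots> = (\<integral>\<^sup>+p. ?f (case p of (w, s) \<Rightarrow> case_nat w s) \<partial>(unif \<Otimes>\<^sub>M S))"
    by (rule nn_integral_distr[OF c]) (use f in simp)
  also have "\<dots> = (\<integral>\<^sup>+w. \<integral>\<^sup>+s. ?f (case_nat w s) \<partial>S \<partial>unif)"
    using measurable_compose[OF c f] by (subst P.nn_integral_fst[symmetric]) auto
  also have "\<dots> = (\<integral>\<^sup>+w. ennreal (stick_prob (x * w) * square_prob (x * (1 - w))) \<partial>unif)"
  proof (rule nn_integral_cong)
    fix w
    let ?E = "{s \<in> space S. stick_ok (x * w) s}"
    have E: "?E \<in> sets S"
      using pred_stick_ok[of "\<lambda>_. x * w" S "\<lambda>s. s"] by simp
    \<comment> \<open>The length left for later rows depends on \<open>w\<close> only, so its factor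
      leaves the integral over the tail \<open>s\<close>.\<close>
    have "(\<integral>\<^sup>+s. ?f (case_nat w s) \<partial>S) =
        (\<integral>\<^sup>+s. ennreal (square_prob (x * (1 - w))) * indicator ?E s \<partial>S)"
      by (rule nn_integral_cong) (auto split: split_indicator)
    also have "\<dots> = ennreal (square_prob (x * (1 - w))) * ennreal (stick_prob (x * w))"
      using E by (simp add: nn_integral_cmult_indicator P.emeasure_eq_measure pieces_prob_def)
    finally show "(\<integral>\<^sup>+s. ?f (case_nat w s) \<partial>S) =
        ennreal (stick_prob (x * w) * square_prob (x * (1 - w)))"
      by (simp add: ennreal_mult'' pieces_prob_nonneg[OF square_facts] mult.commute)
  qed
  finally show "ennreal (square_prob x) = \<dots>" .
qed (use borel_measurable_pieces_prob[OF square_facts] pieces_prob_nonneg[OF square_facts]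
      borel_measurable_pieces_prob[OF stick_facts] pieces_prob_nonneg[OF stick_facts] in auto)

section \<open>Identification with \<open>rho\<close> and uniqueness of \<open>Pf\<close>\<close>

text \<open>Both functions are \<open>1\<close> on \<open>[0,1]\<close> and solve the same Volterra
  equation. As a by-product \<open>rho\<close> takes values in \<open>[0,1]\<close> on nonnegative
  arguments, which later bounds the kernel for \<open>Pf\<close>.\<close>

lemma stick_prob_eq_dickman:
  assumes rho: "is_dickman rho" and "0 \<le> u"
  shows "stick_prob u = rho u"
proof -
  have cont: "continuous_on {0..u} rho"
    using rho by (auto simp: is_dickman_def intro: continuous_on_subset)
  have "bounded (rho ` {0..u})"
    by (intro compact_imp_bounded compact_continuous_image[OF cont] compact_Icc)
  then obtain B where B: "\<And>t. t \<in> {0..u} \<Longrightarrow> norm (rho t) \<le> B"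
    unfolding bounded_iff by blast
  show ?thesis
  \<comment> \<open>The bound is \<open>1\<close> for the probability plus \<open>B\<close> for
    \<open>rho\<close>, which is continuous on a compact interval.\<close>
  proof (rule volterra_unique[where f = stick_prob and g = rho and T = u and k = "\<lambda>u t. of_bool (u - t \<le> 1)" and B = "1 + B"])
    show "stick_prob t = rho t" if "0 \<le> t" "t \<le> 1" for t
      using rho that stick_prob_eq_1[of t] by (auto simp: is_dickman_def)
    show "\<bar>stick_prob t - rho t\<bar> \<le> 1 + B" if "0 \<le> t" "t \<le> u" for t
      using B[of t] pieces_prob_nonneg[OF stick_facts, of t] pieces_prob_le_1[OF stick_facts, of t]
        that by auto
  qed (use assms dickman_delay_equation stick_prob_delay_equation in auto)
qed

text \<open>In the convolution equation \<open>u - t\<close> stays nonnegative, so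
  \<open>stick_prob\<close> may be replaced by \<open>rho\<close>.\<close>

lemma is_Pi_square_prob:
  assumes rho: "is_dickman rho"
  shows "is_Pi rho square_prob"
proof -
  have "((\<lambda>t. square_prob t * rho (u - t)) has_integral u * square_prob u) {0..u}" if "1 < u" for u
    by (rule has_integral_eq[OF _ square_prob_convolution])
       (use that stick_prob_eq_dickman[OF rho] in auto)
  then show ?thesis
    unfolding is_Pi_def using pieces_prob_nonneg[OF square_facts] pieces_prob_le_1[OF square_facts]
    by (auto simp: square_prob_eq_1 has_integral_iff)
qed

text \<open>The kernel \<open>rho (u - t)\<close> is a probability, hence bounded by
  \<open>1\<close> as \<open>volterra_unique\<close> demands.\<close>

lemma is_Pi_unique:
  assumes rho: "is_dickman rho" and "is_Pi rho f" "is_Pi rho g" and "0 < u"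
  shows "f u = g u"
proof (rule volterra_unique[where f = f and g = g and T = u and k = "\<lambda>u t. rho (u - t)" and B = 1])
  show "f t = g t" if "0 \<le> t" "t \<le> 1" for t
    \<comment> \<open>The point \<open>0\<close> lies outside \<open>{0<..1}\<close> and is settled
      by the clause \<open>Pf 0 = 1\<close>.\<close>
    using assms(2,3) that by (cases "t = 0") (auto simp: is_Pi_def)
  have eq: "((\<lambda>s. h s * rho (t - s)) has_integral t * h t) {0..t}" if "1 < t" "is_Pi rho h" for t h
    using that unfolding is_Pi_def has_integral_iff by force
  show "((\<lambda>s. f s * rho (t - s)) has_integral t * f t) {0..t}"
    "((\<lambda>s. g s * rho (t - s)) has_integral t * g t) {0..t}" if "1 < t" for t
    using eq that assms(2,3) by auto
  show "\<bar>rho (t - s)\<bar> \<le> 1" if "0 \<le> s" "s \<le> t" for s t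
    using that pieces_prob_nonneg[OF stick_facts] pieces_prob_le_1[OF stick_facts]
    by (simp flip: stick_prob_eq_dickman[OF rho])
  have "0 \<le> h t \<and> h t \<le> 1" if "is_Pi rho h" "0 \<le> t" for h t
    using that by (cases "t = 0") (auto simp: is_Pi_def)
  then show "\<bar>f t - g t\<bar> \<le> 1" if "0 \<le> t" "t \<le> u" for t
    using that assms(2,3) by (smt (verit))
qed (use assms in auto)

section \<open>The law of the array\<close>

text \<open>Injectivity makes the blocks \<open>{g j}\<close> disjoint; grouping by them and
  projecting to the single coordinate suffices.\<close>

lemma (in prob_space) indep_vars_reindex_inj:
  assumes ind: "indep_vars M' X I" and g: "inj_on g J" "g ` J \<subseteq> I"
  shows "indep_vars (\<lambda>j. M' (g j)) (\<lambda>j. X (g j)) J"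
proof -
  have "indep_vars (\<lambda>j. PiM {g j} M') (\<lambda>j \<omega>. restrict (\<lambda>i. X i \<omega>) {g j}) J"
    using g by (intro indep_vars_restrict[OF ind]) (auto simp: disjoint_family_on_def inj_on_def)
  then have "indep_vars (\<lambda>j. M' (g j)) (\<lambda>j \<omega>. (\<lambda>f. f (g j)) (restrict (\<lambda>i. X i \<omega>) {g j})) J"
    by (rule indep_vars_compose2) measurable
  then show ?thesis by simp
qed

text \<open>Independence enters twice: within a row it gives the law of the row, and between rows,
  taken as disjoint blocks of indices, the law of the array.\<close>

lemma distr_array_eq_PiM:
  fixes U :: "nat \<times> nat \<Rightarrow> 'a \<Rightarrow> real"
  assumes "prob_space M"
    and ind: "prob_space.indep_vars M (\<lambda>_. borel) U ({1..} \<times> {1..})"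
    and unif: "\<And>i j. 1 \<le> i \<Longrightarrow> 1 \<le> j \<Longrightarrow> distr M lborel (U (i, j)) = unif"
  shows "(\<lambda>\<omega> i j. U (Suc i, Suc j) \<omega>) \<in> measurable M (\<Pi>\<^sub>M n\<in>(UNIV :: nat set). unif_seq)" (is "?X \<in> _")
    and "distr M (\<Pi>\<^sub>M n\<in>(UNIV :: nat set). unif_seq) (\<lambda>\<omega> i j. U (Suc i, Suc j) \<omega>) =
      (\<Pi>\<^sub>M n\<in>(UNIV :: nat set). unif_seq)"
proof -
  interpret prob_space M by fact
  \<comment> \<open>\<open>R\<close> has the measurable sets of \<open>unif_seq\<close>, and
    \<open>distr\<close> sees only the sigma-algebra of its target, so the two are interchangeable
    there.\<close>
  define R where "R = (\<Pi>\<^sub>M n\<in>(UNIV :: nat set). (borel :: real measure))"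
  have sets_R: "sets R = sets unif_seq"
    unfolding R_def by (rule sets_PiM_cong) auto
  have space_R: "space R = UNIV"
    unfolding R_def by (simp add: space_PiM)
  have U[measurable]: "U (Suc i, Suc j) \<in> borel_measurable M" for i j
    using ind by (auto simp: indep_vars_def)
  have row[measurable]: "(\<lambda>\<omega> j. U (Suc i, Suc j) \<omega>) \<in> measurable M R" for i
    unfolding R_def by (rule measurable_PiM_single') (auto simp: space_PiM)
  have row_distr: "distr M R (\<lambda>\<omega> j. U (Suc i, Suc j) \<omega>) = unif_seq" for i
  proof -
    have "indep_vars (\<lambda>_. borel) (\<lambda>j. U (Suc i, Suc j)) UNIV"
      using indep_vars_reindex_inj[OF ind, of "\<lambda>j. (Suc i, Suc j)" UNIV] by (auto simp: inj_on_def)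
    then have "distr M R (\<lambda>\<omega> j. U (Suc i, Suc j) \<omega>) =
        (\<Pi>\<^sub>M j\<in>UNIV. distr M borel (U (Suc i, Suc j)))"
      unfolding R_def by (subst (asm) indep_vars_iff_distr_eq_PiM') (auto simp: restrict_UNIV)
    also have "\<dots> = unif_seq"
    proof (rule PiM_cong)
      fix j
      have "distr M borel (U (Suc i, Suc j)) = distr M lborel (U (Suc i, Suc j))"
        by (rule distr_cong) auto
      also have "\<dots> = unif"
        by (rule unif) auto
      finally show "distr M borel (U (Suc i, Suc j)) = unif" .
    qed simp
    finally show ?thesis .
  qed
  \<comment> \<open>\<open>K i\<close> is the block of indices of row \<open>Suc i\<close>.\<close>
  define K where "K = (\<lambda>i::nat. {Suc i} \<times> {1::nat..})"
  have "indep_vars (\<lambda>i. PiM (K i) (\<lambda>_. borel)) (\<lambda>i \<omega>. restrict (\<lambda>p. U p \<omega>) (K i)) UNIV"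
    by (intro indep_vars_restrict[OF ind]) (auto simp: K_def disjoint_family_on_def)
  then have "indep_vars (\<lambda>_. R)
      (\<lambda>i \<omega>. (\<lambda>f j. f (Suc i, Suc j)) (restrict (\<lambda>p. U p \<omega>) (K i))) UNIV"
    unfolding R_def
  proof (rule indep_vars_compose2)
    show "(\<lambda>f j. f (Suc i, Suc j)) \<in> measurable (PiM (K i) (\<lambda>_. borel)) (\<Pi>\<^sub>M n\<in>(UNIV :: nat set). borel)"
      for i
    proof (rule measurable_PiM_single')
      show "(\<lambda>f. f (Suc i, Suc j)) \<in> measurable (PiM (K i) (\<lambda>_. borel)) borel" for j
        by (rule measurable_component_singleton) (simp add: K_def)
    qed simp
  qed
  then have rows: "indep_vars (\<lambda>_. R) (\<lambda>i \<omega> j. U (Suc i, Suc j) \<omega>) UNIV"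
    by (simp add: K_def)
  then have eq: "distr M (\<Pi>\<^sub>M n\<in>(UNIV :: nat set). R) ?X = (\<Pi>\<^sub>M n\<in>(UNIV :: nat set). unif_seq)"
    by (subst (asm) indep_vars_iff_distr_eq_PiM') (auto simp: row_distr restrict_UNIV)
  have sets: "sets (\<Pi>\<^sub>M n\<in>(UNIV :: nat set). R) = sets (\<Pi>\<^sub>M n\<in>(UNIV :: nat set). unif_seq)"
    by (rule sets_PiM_cong) (auto simp: sets_R)
  have "?X \<in> measurable M (\<Pi>\<^sub>M n\<in>(UNIV :: nat set). R)"
    by (rule measurable_PiM_single') (auto simp: space_PiM space_R)
  then show "?X \<in> measurable M (\<Pi>\<^sub>M n\<in>(UNIV :: nat set). unif_seq)"
    by (simp only: measurable_cong_sets[OF refl sets])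
  have "distr M (\<Pi>\<^sub>M n\<in>(UNIV :: nat set). unif_seq) ?X = distr M (\<Pi>\<^sub>M n\<in>(UNIV :: nat set). R) ?X"
    by (rule distr_cong[OF refl sets[symmetric]]) (rule refl)
  also note eq
  finally show "distr M (\<Pi>\<^sub>M n\<in>(UNIV :: nat set). unif_seq) ?X = (\<Pi>\<^sub>M n\<in>(UNIV :: nat set). unif_seq)" .
qed

section \<open>From the largest part to the breaking process\<close>

lemma square_part_Suc:
  "square_part U (Suc i) (Suc (Suc j)) \<omega> =
     (\<Prod>r<i. 1 - U (Suc r, Suc 0) \<omega>) * U (Suc i, Suc 0) \<omega> *
     (\<Prod>s<j. 1 - U (Suc i, Suc (Suc s)) \<omega>) * U (Suc i, Suc (Suc j)) \<omega>"
  unfolding square_part_def numeral_2_eq_2 One_nat_def prod.shift_bounds_Suc_ivl atLeast0LessThan ..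

text \<open>Dividing every part by \<open>u\<close> moves the threshold to \<open>1\<close> and the
  initial length to \<open>1 / u\<close>.\<close>

lemma largest_part_le_iff:
  assumes "0 < u"
  shows "largest_part U \<omega> \<le> ereal u \<longleftrightarrow> square_ok (1 / u) (\<lambda>i j. U (Suc i, Suc j) \<omega>)"
proof -
  have "largest_part U \<omega> \<le> ereal u \<longleftrightarrow>
      (\<forall>i\<ge>1. \<forall>j\<ge>2. square_part U i j \<omega> \<le> u)"
    by (auto simp: largest_part_def SUP_le_iff)
  also have "\<dots> \<longleftrightarrow> (\<forall>i j. square_part U (Suc i) (Suc (Suc j)) \<omega> \<le> u)"
  proof (intro iffI allI impI)
    fix i j :: nat
    assume parts: "\<forall>i j. square_part U (Suc i) (Suc (Suc j)) \<omega> \<le> u" and "1 \<le> i" "2 \<le> j"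
    \<comment> \<open>The truncated subtractions are exact by the lower bounds on \<open>i\<close>
      and \<open>j\<close>.\<close>
    then have "Suc (i - 1) = i" "Suc (Suc (j - 2)) = j" by auto
    with parts show "square_part U i j \<omega> \<le> u" by metis
  qed auto
  also have "\<dots> \<longleftrightarrow> square_ok (1 / u) (\<lambda>i j. U (Suc i, Suc j) \<omega>)"
    unfolding pieces_ok_def square_part_Suc using \<open>0 < u\<close> by (simp add: field_simps)
  finally show ?thesis .
qed

theorem mainTheorem3:
  fixes M :: "'a measure" and U :: "nat \<times> nat \<Rightarrow> 'a \<Rightarrow> real" and rho :: "real \<Rightarrow> real"
  assumes "prob_space M"
    and "prob_space.indep_vars M (\<lambda>_. borel) U ({1..} \<times> {1..})"
    and "\<And>i j. 1 \<le> i \<Longrightarrow> 1 \<le> j \<Longrightarrow> distr M lborel (U (i, j)) = uniform_measure lborel {0..1}"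
    and "is_dickman rho"
  shows "(\<exists>Pf. is_Pi rho Pf) \<and>
         (\<forall>Pf. is_Pi rho Pf \<longrightarrow>
            (\<forall>u>0. measure M {\<omega> \<in> space M. largest_part U \<omega> \<le> ereal u} = Pf (1 / u)))"
proof (intro conjI allI impI)
  note Pi = is_Pi_square_prob[OF assms(4)]
  show "\<exists>Pf. is_Pi rho Pf" using Pi by blast
  fix Pf :: "real \<Rightarrow> real" and u :: real
  assume Pf: "is_Pi rho Pf" and u: "0 < u"
  let ?S = "\<Pi>\<^sub>M n\<in>(UNIV :: nat set). unif_seq"
  let ?X = "\<lambda>\<omega> i j. U (Suc i, Suc j) \<omega>"
  let ?E = "{s \<in> space ?S. square_ok (1 / u) s}"
  have X: "?X \<in> measurable M ?S" "distr M ?S ?X = ?S"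
    using assms(1-3) by (rule distr_array_eq_PiM; blast)+
  have E: "?E \<in> sets ?S"
    using pred_compose_Pair[OF pred_pieces_ok[OF square_facts(2,3)], of "\<lambda>_. 1 / u" ?S "\<lambda>s. s"]
    by simp
  \<comment> \<open>The event is pulled back from the product space, where its probability is
    \<open>square_prob (1 / u)\<close> by definition.\<close>
  have "{\<omega> \<in> space M. largest_part U \<omega> \<le> ereal u} = ?X -` ?E \<inter> space M"
    using measurable_space[OF X(1)] by (auto simp: largest_part_le_iff[OF u])
  then have "measure M {\<omega> \<in> space M. largest_part U \<omega> \<le> ereal u} = measure (distr M ?S ?X) ?E"
    using X(1) E by (simp only: measure_distr)
  also have "\<dots> = square_prob (1 / u)"
    unfolding X(2) pieces_prob_def ..
  also have "\<dots> = Pf (1 / u)"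
    by (rule is_Pi_unique[OF assms(4) Pi Pf]) (use u in simp)
  finally show "measure M {\<omega> \<in> space M. largest_part U \<omega> \<le> ereal u} = Pf (1 / u)" .
qed

end
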